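(* Let $F=F_1\times\cdots\times F_m$ be a product distribution and consider $n$ additive bidders whose valuations are sampled i.i.d. from $F$. Then the optimal expected revenue $\mathrm{Rev}$ of a BIC and BIR mechanism satisfies $$\mathrm{Rev}\le\sum_{j=1}^m\mathbb E_{\mathbf v\sim F^n}\Big[\max_{i\in[n]}\Big(\varphi_j(v_{ij})^+\cdot\mathbb I_{v_i\in R_j}+v_{ij}\cdot\mathbb I_{v_i\notin R_j}\Big)\Big].$$
   Context: There are $m$ items. Each $F_j$ is a distribution with finite support $T_j\subset[0,\infty)$, probability mass function $f_j$ and CDF also denoted $F_j$. Its (Myerson) virtual value function is $\varphi_j(x)=x-\frac{(x'-x)(1-F_j(x))}{f_j(x)}$ for $x\in T_j$, where $x'$ is the next larger element of $T_j$, and $\varphi_j(\max T_j)=\max T_j$. Write $y^+=\max\{y,0\}$. A profile $\mathbf v=(v_1,\dots,v_n)\sim F^n$ has $v_i=(v_{i1},\dots,v_{im})$ with all $v_{ij}\sim F_j$ independent. An additive bidder $i$ has value $\sum_{j\in S}v_{ij}$ for a set $S$ of items; utilities are quasi-linear. The quantile-based region of item $j$ is $R_j=\{v=(v_1,\dots,v_m): F_j(v_j)>F_{j'}(v_{j'})\ \forall j'\ne j\}$, with ties broken lexicographically (a tie between $j$ and $j'$ is won by the smaller index). A (possibly randomized) mechanism maps bids to an allocation of the items (each item to at most one bidder) and payments. It is BIC if truth-telling maximizes each bidder's expected utility given that the others report truthfully, and BIR if each bidder's expected utility from truthful reporting is non-negative (expectations over the mechanism's randomness and the others' valuations). $\mathrm{Rev}$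 is the optimal expected revenue over all BIC and BIR mechanisms. *)

theory Defs
  imports "HOL-Probability.Probability"
begin

text \<open>
  Items are \<open>{..<m}\<close>, bidders are \<open>{..<n}\<close>; \<open>F j\<close> is the distribution of a single bidder's value
  for item \<open>j\<close>. Its mass function is \<open>pmf (F j)\<close>, its support \<open>set_pmf (F j)\<close> and its
  CDF \<open>cdf (F j)\<close>.
\<close>

type_synonym valuation = "nat \<Rightarrow> real"
type_synonym profile = "nat \<Rightarrow> valuation"

definition virtual_value :: "real pmf \<Rightarrow> real \<Rightarrow> real" where
  "virtual_value p x =
     (if x = Max (set_pmf p) then x
      else x - (Min {y \<in> set_pmf p. x < y} - x) * (1 - cdf (measure_pmf p) x) / pmf p x)"

definition quantile_region :: "nat \<Rightarrow> (nat \<Rightarrow> real pmf) \<Rightarrow> nat \<Rightarrow> valuation set" where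
  "quantile_region m F j =
     {v. \<forall>k<m. k \<noteq> j \<longrightarrow>
           cdf (measure_pmf (F j)) (v j) > cdf (measure_pmf (F k)) (v k) \<or>
           cdf (measure_pmf (F j)) (v j) = cdf (measure_pmf (F k)) (v k) \<and> j < k}"

definition valuation_pmf :: "nat \<Rightarrow> (nat \<Rightarrow> real pmf) \<Rightarrow> valuation pmf" where
  "valuation_pmf m F = Pi_pmf {..<m} 0 F"

definition profile_pmf :: "nat set \<Rightarrow> nat \<Rightarrow> (nat \<Rightarrow> real pmf) \<Rightarrow> profile pmf" where
  "profile_pmf I m F = Pi_pmf I (\<lambda>_. 0) (\<lambda>_. valuation_pmf m F)"

text \<open>
  An outcome is a pair \<open>(a, p)\<close>: \<open>a j = Some i\<close> means that item \<open>j\<close> goes to bidder \<open>i\<close>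
  (\<open>None\<close>: it is not allocated), and \<open>p i\<close> is the (possibly negative) payment of bidder \<open>i\<close>.
\<close>

type_synonym outcome = "(nat \<Rightarrow> nat option) \<times> (nat \<Rightarrow> real)"

definition outcome_space :: "nat \<Rightarrow> nat \<Rightarrow> outcome measure" where
  "outcome_space m n =
     (\<Pi>\<^sub>M j\<in>{..<m}. count_space (insert None (Some ` {..<n}))) \<Otimes>\<^sub>M
     (\<Pi>\<^sub>M i\<in>{..<n}. borel)"

text \<open>
  A randomized mechanism sends each bid profile to the distribution of its outcome. Bids range
  over the valuations in the support of \<open>F\<close>; the value of a mechanism at any other profile is
  irrelevant. Payments have to be integrable so that all expectations below exist.
\<close>

type_synonym mechanism = "profile \<Rightarrow> outcome measure"

definition is_mechanism :: "nat \<Rightarrow> nat \<Rightarrow> (nat \<Rightarrow> real pmf) \<Rightarrow> mechanism \<Rightarrow> bool" where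
  "is_mechanism m n F M \<longleftrightarrow>
     (\<forall>b \<in> set_pmf (profile_pmf {..<n} m F).
        prob_space (M b) \<and> sets (M b) = sets (outcome_space m n) \<and>
        (\<forall>i<n. integrable (M b) (\<lambda>(a, p). p i)))"

definition bidder_utility :: "nat \<Rightarrow> nat \<Rightarrow> valuation \<Rightarrow> outcome \<Rightarrow> real" where
  "bidder_utility m i v = (\<lambda>(a, p). (\<Sum>j\<in>{j. j < m \<and> a j = Some i}. v j) - p i)"

text \<open>
  Expected utility of bidder \<open>i\<close> with valuation \<open>v\<close> who bids \<open>b\<close> while all others bid truthfully.
\<close>

definition interim_utility ::
  "nat \<Rightarrow> nat \<Rightarrow> (nat \<Rightarrow> real pmf) \<Rightarrow> mechanism \<Rightarrow> nat \<Rightarrow> valuation \<Rightarrow> valuation \<Rightarrow> real" where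
  "interim_utility m n F M i v b =
     measure_pmf.expectation (profile_pmf ({..<n} - {i}) m F)
       (\<lambda>w. \<integral>x. bidder_utility m i v x \<partial>M (w(i := b)))"

definition BIC :: "nat \<Rightarrow> nat \<Rightarrow> (nat \<Rightarrow> real pmf) \<Rightarrow> mechanism \<Rightarrow> bool" where
  "BIC m n F M \<longleftrightarrow>
     (\<forall>i<n. \<forall>v \<in> set_pmf (valuation_pmf m F). \<forall>b \<in> set_pmf (valuation_pmf m F).
        interim_utility m n F M i v b \<le> interim_utility m n F M i v v)"

definition BIR :: "nat \<Rightarrow> nat \<Rightarrow> (nat \<Rightarrow> real pmf) \<Rightarrow> mechanism \<Rightarrow> bool" where
  "BIR m n F M \<longleftrightarrow>
     (\<forall>i<n. \<forall>v \<in> set_pmf (valuation_pmf m F). 0 \<le> interim_utility m n F M i v v)"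

definition revenue :: "nat \<Rightarrow> nat \<Rightarrow> (nat \<Rightarrow> real pmf) \<Rightarrow> mechanism \<Rightarrow> real" where
  "revenue m n F M =
     measure_pmf.expectation (profile_pmf {..<n} m F)
       (\<lambda>v. \<integral>(a, p). (\<Sum>i<n. p i) \<partial>M v)"

text \<open>
  The supremum is taken in \<^typ>\<open>ereal\<close>, so that no boundedness is presupposed.
\<close>

definition Rev :: "nat \<Rightarrow> nat \<Rightarrow> (nat \<Rightarrow> real pmf) \<Rightarrow> ereal" where
  "Rev m n F =
     (SUP M \<in> {M. is_mechanism m n F M \<and> BIC m n F M \<and> BIR m n F M}. ereal (revenue m n F M))"

end

theory Submission
  imports Defs
begin

text \<open>
  Raising \<open>v j\<close> keeps a valuation inside \<open>R j\<close>, so each line in direction \<open>j\<close> meets \<open>R j\<close> in an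
  upper segment. Along it, incentive compatibility between neighbouring values bounds the growth of the
  interim utility \<open>u\<close> from below by the interim probability \<open>x j\<close> of winning item \<open>j\<close>, and individual
  rationality bounds \<open>u\<close> at the bottom. Summation by parts turns this into
  \<open>E [u 1(R j)] \<ge> E [(v j - \<phi> j (v j)) (x j) 1(R j)]\<close>. The regions are disjoint and \<open>u \<ge> 0\<close>, hence \<open>E u\<close>
  is at least the sum over \<open>j\<close>; the payment is welfare minus utility, so it is at most the expected
  virtual welfare, in which item \<open>j\<close> is won by at most one bidder. No ironing is needed for an upper bound.
\<close>

section \<open>One-dimensional distributions and virtual values\<close>

lemma one_minus_cdf_eq_sum_pmf:
  assumes "finite (set_pmf p)"
  shows "1 - cdf (measure_pmf p) t = (\<Sum>s\<in>{s\<in>set_pmf p. t < s}. pmf p s)"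
proof -
  have "1 - cdf (measure_pmf p) t = measure_pmf.prob p (- {..t})"
    using measure_pmf.prob_compl[of "{..t}" p] by (simp add: cdf_def Compl_eq_Diff_UNIV)
  also have "\<dots> = measure_pmf.prob p (- {..t} \<inter> set_pmf p)"
    by (simp add: measure_Int_set_pmf)
  also have "\<dots> = (\<Sum>s\<in>{s\<in>set_pmf p. t < s}. pmf p s)"
    using assms by (subst measure_measure_pmf_finite) (auto intro: sum.cong)
  finally show ?thesis .
qed

lemma cdf_pmf_mono: "s \<le> t \<Longrightarrow> cdf (measure_pmf p) s \<le> cdf (measure_pmf p) t"
  unfolding cdf_def by (rule measure_pmf.finite_measure_mono) auto

text \<open>
  Telescoping from the maximum of the support downwards: \<open>(s - \<phi> s) f s\<close> is the gap to the next value
  times the probability of exceeding \<open>s\<close>.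
\<close>

lemma virtual_value_tail_bound:
  fixes p :: "real pmf" and u x :: "real \<Rightarrow> real"
  assumes fin: "finite (set_pmf p)" and t: "t \<in> set_pmf p"
    and ic: "\<And>r s. r \<in> set_pmf p \<Longrightarrow> s \<in> set_pmf p \<Longrightarrow> t \<le> r \<Longrightarrow> r \<le> s \<Longrightarrow>
               u r + (s - r) * x r \<le> u s"
  shows "u t * (\<Sum>s\<in>{s\<in>set_pmf p. t \<le> s}. pmf p s) +
      (\<Sum>s\<in>{s\<in>set_pmf p. t \<le> s}. (s - virtual_value p s) * x s * pmf p s)
      \<le> (\<Sum>s\<in>{s\<in>set_pmf p. t \<le> s}. u s * pmf p s)"
  using t ic
proof (induction "card {s\<in>set_pmf p. t \<le> s}" arbitrary: t rule: less_induct)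
  case less
  show ?case
  proof (cases "t = Max (set_pmf p)")
    case True
    \<comment> \<open>At the top of the support the virtual value is the value itself, so the second
      sum vanishes and both sides equal \<open>u t * pmf p t\<close>.\<close>
    then have "{s\<in>set_pmf p. t \<le> s} = {t}"
      using fin less.prems(1) by (auto intro: antisym Max_ge)
    then show ?thesis
      using True by (simp add: virtual_value_def)
  next
    case False
    define N where "N = {y\<in>set_pmf p. t < y}"
    define t' where "t' = Min N"
    have "t < Max (set_pmf p)"
      using False fin less.prems(1) Max_ge[of "set_pmf p" t] by linarith
    then have "N \<noteq> {}" "finite N"
      using fin Max_in[OF fin set_pmf_not_empty] by (auto simp: N_def)
    then have t'N: "t' \<in> N" and t'min: "\<And>s. s \<in> N \<Longrightarrow> t' \<le> s"
      by (auto simp: t'_def)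
    then have t': "t' \<in> set_pmf p" "t < t'"
      by (auto simp: N_def)
    have N: "{s\<in>set_pmf p. t' \<le> s} = N"
      using t'min t' by (auto simp: N_def)
    have ge: "{s\<in>set_pmf p. t \<le> s} = insert t N" "t \<notin> N"
      using less.prems(1) by (auto simp: N_def)
    have "u t' * (\<Sum>s\<in>N. pmf p s) + (\<Sum>s\<in>N. (s - virtual_value p s) * x s * pmf p s)
        \<le> (\<Sum>s\<in>N. u s * pmf p s)"
      using less.hyps[of t'] t' \<open>finite N\<close> ge less.prems(2) unfolding N by simp
    \<comment> \<open>Incentive compatibility between the neighbours \<open>t\<close> and
      \<open>t'\<close>, weighted by the mass strictly above \<open>t\<close>; it lowers the
      boundary value of the induction hypothesis from \<open>u t'\<close> to \<open>u t\<close> and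
      releases the summand at \<open>t\<close>.\<close>
    moreover have "(u t + (t' - t) * x t) * (\<Sum>s\<in>N. pmf p s) \<le> u t' * (\<Sum>s\<in>N. pmf p s)"
      using less.prems t' by (intro mult_right_mono sum_nonneg) auto
    \<comment> \<open>The definition of the virtual value with its denominator cleared, which is
      possible because \<open>pmf p t\<close> is nonzero on the support.\<close>
    moreover have "(t - virtual_value p t) * pmf p t = (t' - t) * (\<Sum>s\<in>N. pmf p s)"
      using False less.prems(1) one_minus_cdf_eq_sum_pmf[OF fin, of t]
      by (simp add: virtual_value_def t'_def N_def set_pmf_iff)
    then have "(t - virtual_value p t) * x t * pmf p t = (t' - t) * x t * (\<Sum>s\<in>N. pmf p s)"
      by (metis mult.assoc mult.commute)
    ultimately show ?thesis
      using \<open>finite N\<close> ge by (simp add: algebra_simps)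
  qed
qed

text \<open>By upward closure, \<open>U\<close> contains exactly the support points from its least
  one \<open>t\<close> on, so the tail bound at \<open>t\<close> applies. Its boundary term,
  \<open>u t\<close> times the tail mass, is nonnegative and is dropped; this is how individual
  rationality enters.\<close>

lemma virtual_value_bound:
  fixes p :: "real pmf" and u x :: "real \<Rightarrow> real"
  assumes fin: "finite (set_pmf p)"
    and up: "\<And>s t. s \<in> set_pmf p \<Longrightarrow> t \<in> set_pmf p \<Longrightarrow> s \<in> U \<Longrightarrow> s \<le> t \<Longrightarrow> t \<in> U"
    and nonneg: "\<And>t. t \<in> set_pmf p \<Longrightarrow> 0 \<le> u t"
    and ic: "\<And>s t. s \<in> set_pmf p \<Longrightarrow> t \<in> set_pmf p \<Longrightarrow> u s + (t - s) * x s \<le> u t"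
  shows "measure_pmf.expectation p (\<lambda>t. (t - virtual_value p t) * x t * indicator U t)
    \<le> measure_pmf.expectation p (\<lambda>t. u t * indicator U t)"
proof (cases "set_pmf p \<inter> U = {}")
  case True
  then have *: "indicator U s = (0::real)" if "s \<in> set_pmf p" for s
    using that by (auto simp: indicator_def)
  show ?thesis
    by (simp add: * integral_measure_pmf_real[OF fin] cong: sum.cong)
next
  case False
  define t where "t = Min (set_pmf p \<inter> U)"
  have t: "t \<in> set_pmf p" "t \<in> U"
    using Min_in[OF _ False] fin by (auto simp: t_def)
  have "t \<le> s" if "s \<in> set_pmf p" "s \<in> U" for s
    using that fin by (auto simp: t_def)
  then have U: "set_pmf p \<inter> U = {s\<in>set_pmf p. t \<le> s}"
    using t up by blast
  have E: "measure_pmf.expectation p (\<lambda>s. g s * indicator U s)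
      = (\<Sum>s\<in>{s\<in>set_pmf p. t \<le> s}. g s * pmf p s)" for g :: "real \<Rightarrow> real"
    unfolding U[symmetric] using fin
    by (subst integral_measure_pmf_real[of "set_pmf p \<inter> U"]) (auto simp: indicator_def split: if_splits)
  have "0 \<le> u t * (\<Sum>s\<in>{s\<in>set_pmf p. t \<le> s}. pmf p s)"
    using nonneg t by (intro mult_nonneg_nonneg sum_nonneg) auto
  then show ?thesis
    using virtual_value_tail_bound[OF fin t(1), of u x] ic unfolding E by force
qed

section \<open>Expectations over finitely supported product distributions\<close>

lemma finite_set_Pi_pmf:
  assumes "finite I" "\<And>k. k \<in> I \<Longrightarrow> finite (set_pmf (p k))"
  shows "finite (set_pmf (Pi_pmf I d p))"
  using assms by (simp add: set_Pi_pmf finite_PiE_dflt)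

lemma fun_upd_in_set_Pi_pmf:
  assumes "finite I" "i \<in> I" "w \<in> set_pmf (Pi_pmf (I - {i}) d p)" "t \<in> set_pmf (p i)"
  shows "w(i := t) \<in> set_pmf (Pi_pmf I d p)"
  using assms by (auto simp: set_Pi_pmf PiE_dflt_def)

text \<open>Fubini with coordinate \<open>i\<close> drawn last. It serves on two levels: to isolate
  one item within a valuation and one bidder within a profile.\<close>

lemma expectation_Pi_pmf_split:
  fixes h :: "('a \<Rightarrow> 'b) \<Rightarrow> real"
  assumes "finite I" "i \<in> I" "\<And>k. k \<in> I \<Longrightarrow> finite (set_pmf (p k))"
  shows "measure_pmf.expectation (Pi_pmf I d p) h =
    measure_pmf.expectation (Pi_pmf (I - {i}) d p)
      (\<lambda>w. measure_pmf.expectation (p i) (\<lambda>t. h (w(i := t))))"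
proof -
  have I: "I = insert i (I - {i})"
    using assms(2) by auto
  \<comment> \<open>\<open>Pi_pmf_insert'\<close> draws coordinate \<open>i\<close> first; commuting
    the two independent draws moves it to the end.\<close>
  have "Pi_pmf I d p = Pi_pmf (I - {i}) d p \<bind> (\<lambda>w. map_pmf (\<lambda>t. w(i := t)) (p i))"
    using assms(1)
    by (subst I, subst Pi_pmf_insert') (auto simp: map_pmf_def bind_commute_pmf[of "p i"])
  also have "measure_pmf.expectation \<dots> h = measure_pmf.expectation (Pi_pmf (I - {i}) d p)
      (\<lambda>w. measure_pmf.expectation (map_pmf (\<lambda>t. w(i := t)) (p i)) h)"
    using assms finite_set_Pi_pmf[of "I - {i}" p d]
    by (subst pmf_expectation_bind[of "set_pmf (Pi_pmf (I - {i}) d p)"])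
      (auto simp: integral_measure_pmf[of "set_pmf (Pi_pmf (I - {i}) d p)"])
  finally show ?thesis
    unfolding integral_map_pmf .
qed

lemma expectation_mono_support:
  fixes f g :: "'a \<Rightarrow> real"
  assumes "finite (set_pmf p)" "\<And>x. x \<in> set_pmf p \<Longrightarrow> f x \<le> g x"
  shows "measure_pmf.expectation p f \<le> measure_pmf.expectation p g"
  using assms
  by (intro integral_mono_AE integrable_measure_pmf_finite) (auto simp: AE_measure_pmf_iff)

lemma expectation_cong_support:
  fixes f g :: "'a \<Rightarrow> real"
  assumes "\<And>x. x \<in> set_pmf p \<Longrightarrow> f x = g x"
  shows "measure_pmf.expectation p f = measure_pmf.expectation p g"
  using assms by (intro integral_cong_AE) (auto simp: AE_measure_pmf_iff)

lemma expectation_swap_finite: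
  fixes h :: "'a \<Rightarrow> 'b \<Rightarrow> real"
  assumes "finite (set_pmf p)" "finite (set_pmf q)"
  shows "measure_pmf.expectation p (\<lambda>x. measure_pmf.expectation q (h x)) =
    measure_pmf.expectation q (\<lambda>y. measure_pmf.expectation p (\<lambda>x. h x y))"
proof -
  have "measure_pmf.expectation p (\<lambda>x. measure_pmf.expectation q (h x)) =
      (\<Sum>x\<in>set_pmf p. \<Sum>y\<in>set_pmf q. h x y * pmf q y * pmf p x)"
    using assms
    by (simp add: integral_measure_pmf_real[of "set_pmf p" p] integral_measure_pmf_real[of "set_pmf q" q]
        sum_distrib_right)
  also have "\<dots> = (\<Sum>y\<in>set_pmf q. \<Sum>x\<in>set_pmf p. h x y * pmf p x * pmf q y)"
    by (subst sum.swap) (simp add: mult_ac)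
  also have "\<dots> = measure_pmf.expectation q (\<lambda>y. measure_pmf.expectation p (\<lambda>x. h x y))"
    using assms
    by (simp add: integral_measure_pmf_real[of "set_pmf p" p] integral_measure_pmf_real[of "set_pmf q" q]
        sum_distrib_right)
  finally show ?thesis .
qed

section \<open>Quantile regions and the lower bound on expected utility\<close>

lemma quantile_region_upward_closed:
  assumes "w(j := s) \<in> quantile_region m F j" "s \<le> t"
  shows "w(j := t) \<in> quantile_region m F j"
proof -
  have "cdf (measure_pmf (F j)) s \<le> cdf (measure_pmf (F j)) t"
    using assms(2) by (rule cdf_pmf_mono)
  then show ?thesis
    using assms(1) unfolding quantile_region_def by fastforce
qed

text \<open>If \<open>j\<close> and \<open>k\<close> differed, each would have to beat the other in
  the lexicographic order by quantile and then index.\<close>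

lemma quantile_region_disjoint:
  assumes "v \<in> quantile_region m F j" "v \<in> quantile_region m F k" "j < m" "k < m"
  shows "j = k"
  using assms unfolding quantile_region_def by fastforce

lemma sum_indicator_quantile_region_le_1:
  "(\<Sum>j<m. indicator (quantile_region m F j) v) \<le> (1::real)"
proof (cases "\<exists>k<m. v \<in> quantile_region m F k")
  case True
  then obtain k where "k < m" "v \<in> quantile_region m F k"
    by blast
  then have "(\<Sum>j<m. indicator (quantile_region m F j) v) = (\<Sum>j<m. if j = k then 1 else (0::real))"
    using quantile_region_disjoint by (intro sum.cong) (auto simp: indicator_def)
  then show ?thesis
    using \<open>k < m\<close> by simp
next
  case False
  then have "(\<Sum>j<m. indicator (quantile_region m F j) v) = (\<Sum>j<m. (0::real))"
    by (intro sum.cong) auto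
  then show ?thesis
    by simp
qed

lemma finite_valuation_pmf:
  assumes "\<And>j. j < m \<Longrightarrow> finite (set_pmf (F j))"
  shows "finite (set_pmf (valuation_pmf m F))"
  unfolding valuation_pmf_def using assms by (intro finite_set_Pi_pmf) auto

text \<open>Single-bidder form of the argument: \<open>u\<close> stands for the truthful interim
  utility and \<open>x b j\<close> for the interim probability of winning item \<open>j\<close> with
  bid \<open>b\<close>. The one-dimensional bound is applied on every line in direction
  \<open>j\<close>, separately for each item.\<close>

lemma expected_utility_lower_bound:
  assumes fin: "\<And>j. j < m \<Longrightarrow> finite (set_pmf (F j))"
    and nonneg: "\<And>v. v \<in> set_pmf (valuation_pmf m F) \<Longrightarrow> 0 \<le> u v"
    and ic: "\<And>v b. v \<in> set_pmf (valuation_pmf m F) \<Longrightarrow> b \<in> set_pmf (valuation_pmf m F) \<Longrightarrow>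
               u b + (\<Sum>j<m. (v j - b j) * x b j) \<le> u v"
  shows "measure_pmf.expectation (valuation_pmf m F)
      (\<lambda>v. \<Sum>j<m. (v j - virtual_value (F j) (v j)) * x v j * indicator (quantile_region m F j) v)
    \<le> measure_pmf.expectation (valuation_pmf m F) u"
proof -
  let ?E = "measure_pmf.expectation (valuation_pmf m F)"
  let ?R = "quantile_region m F"
  note finV = finite_valuation_pmf[OF fin]
  note intV = integrable_measure_pmf_finite[OF finV]
  have item: "?E (\<lambda>v. (v j - virtual_value (F j) (v j)) * x v j * indicator (?R j) v)
      \<le> ?E (\<lambda>v. u v * indicator (?R j) v)" if j: "j < m" for j
  proof -
    let ?P = "Pi_pmf ({..<m} - {j}) 0 F"
    have E: "?E h = measure_pmf.expectation ?P (\<lambda>w. measure_pmf.expectation (F j) (\<lambda>t. h (w(j := t))))"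
      for h :: "valuation \<Rightarrow> real"
      unfolding valuation_pmf_def using fin j by (intro expectation_Pi_pmf_split) auto
    \<comment> \<open>The other values \<open>w\<close> are fixed, and the upward closed set is the
      section of the region along direction \<open>j\<close>.\<close>
    have "measure_pmf.expectation (F j) (\<lambda>t. (t - virtual_value (F j) t) * x (w(j := t)) j *
          indicator {t. w(j := t) \<in> ?R j} t)
        \<le> measure_pmf.expectation (F j) (\<lambda>t. u (w(j := t)) * indicator {t. w(j := t) \<in> ?R j} t)"
      if w: "w \<in> set_pmf ?P" for w
    proof (rule virtual_value_bound)
      have V: "w(j := t) \<in> set_pmf (valuation_pmf m F)" if "t \<in> set_pmf (F j)" for t
        unfolding valuation_pmf_def using w j that by (intro fun_upd_in_set_Pi_pmf) auto
      show "finite (set_pmf (F j))"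
        using fin j .
      show "t \<in> {t. w(j := t) \<in> ?R j}" if "s \<in> {t. w(j := t) \<in> ?R j}" "s \<le> t" for s t
        using quantile_region_upward_closed that by blast
      show "0 \<le> u (w(j := t))" if "t \<in> set_pmf (F j)" for t
        using nonneg V that by blast
      show "u (w(j := s)) + (t - s) * x (w(j := s)) j \<le> u (w(j := t))"
        if st: "s \<in> set_pmf (F j)" "t \<in> set_pmf (F j)" for s t
      proof -
        \<comment> \<open>The two valuations differ only in coordinate \<open>j\<close>, so
          multidimensional incentive compatibility collapses to its one-dimensional form.\<close>
        have "(\<Sum>k<m. ((w(j := t)) k - (w(j := s)) k) * x (w(j := s)) k)
            = (\<Sum>k<m. if k = j then (t - s) * x (w(j := s)) j else 0)"
          by (intro sum.cong) auto
        also have "\<dots> = (t - s) * x (w(j := s)) j"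
          using j by simp
        finally show ?thesis
          using ic[OF V[OF st(2)] V[OF st(1)]] by linarith
      qed
    qed
    then have "measure_pmf.expectation ?P (\<lambda>w. measure_pmf.expectation (F j)
          (\<lambda>t. (t - virtual_value (F j) t) * x (w(j := t)) j * indicator (?R j) (w(j := t))))
        \<le> measure_pmf.expectation ?P (\<lambda>w. measure_pmf.expectation (F j)
          (\<lambda>t. u (w(j := t)) * indicator (?R j) (w(j := t))))"
      using fin by (intro expectation_mono_support[OF finite_set_Pi_pmf]) (simp_all add: indicator_def)
    then show ?thesis
      unfolding E by simp
  qed
  have "?E (\<lambda>v. \<Sum>j<m. (v j - virtual_value (F j) (v j)) * x v j * indicator (?R j) v)
      = (\<Sum>j<m. ?E (\<lambda>v. (v j - virtual_value (F j) (v j)) * x v j * indicator (?R j) v))"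
    by (intro Bochner_Integration.integral_sum intV)
  also have "\<dots> \<le> (\<Sum>j<m. ?E (\<lambda>v. u v * indicator (?R j) v))"
    using item by (intro sum_mono) auto
  also have "\<dots> = ?E (\<lambda>v. \<Sum>j<m. u v * indicator (?R j) v)"
    by (intro Bochner_Integration.integral_sum[symmetric] intV)
  \<comment> \<open>Since the regions are disjoint and \<open>u\<close> is nonnegative, the utility
    is counted at most once.\<close>
  also have "\<dots> \<le> ?E u"
  proof (intro expectation_mono_support finV)
    fix v assume "v \<in> set_pmf (valuation_pmf m F)"
    then show "(\<Sum>j<m. u v * indicator (?R j) v) \<le> u v"
      using nonneg[of v] mult_left_mono[OF sum_indicator_quantile_region_le_1, of "u v" m F v]
      by (simp add: sum_distrib_left)
  qed
  finally show ?thesis .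
qed

section \<open>Random outcomes at a fixed bid profile\<close>

lemma assigned_measurable:
  assumes "sets N = sets (outcome_space m n)" "j < m"
  shows "(\<lambda>x. of_bool (fst x j = Some i) :: real) \<in> borel_measurable N"
proof -
  have "(\<lambda>x. fst x j) \<in> measurable (outcome_space m n) (count_space (insert None (Some ` {..<n})))"
    unfolding outcome_space_def using assms(2) by simp
  then have "(\<lambda>x. of_bool (fst x j = Some i) :: real) \<in> borel_measurable (outcome_space m n)"
    by (rule measurable_compose) simp
  then show ?thesis
    using measurable_cong_sets[OF assms(1) refl] by blast
qed

lemma assigned_integrable:
  assumes "prob_space N" "sets N = sets (outcome_space m n)" "j < m"
  shows "integrable N (\<lambda>x. of_bool (fst x j = Some i) :: real)"
proof -
  interpret prob_space N by fact
  show ?thesis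
    using assms by (intro integrable_const_bound[of _ 1] assigned_measurable) auto
qed

lemma integral_bidder_utility:
  assumes "prob_space N" "sets N = sets (outcome_space m n)" "integrable N (\<lambda>(a, p). p i)"
  shows "(\<integral>x. bidder_utility m i v x \<partial>N) =
    (\<Sum>j<m. v j * (\<integral>x. of_bool (fst x j = Some i) \<partial>N)) - (\<integral>x. snd x i \<partial>N)"
proof -
  \<comment> \<open>The sum over the random set of items won becomes a sum over a fixed index set
    with 0-1 weights, so that linearity of the integral applies.\<close>
  have "bidder_utility m i v = (\<lambda>x. (\<Sum>j<m. v j * of_bool (fst x j = Some i)) - snd x i)"
    unfolding bidder_utility_def
    by (force simp: fun_eq_iff of_bool_def if_distrib[of "(*) _"] sum.If_cases
        intro: sum.cong cong: if_cong)
  moreover have int: "integrable N (\<lambda>x. v j * of_bool (fst x j = Some i))" if "j < m" for j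
    using assigned_integrable[OF assms(1,2) that] by simp
  ultimately have "(\<integral>x. bidder_utility m i v x \<partial>N) =
      (\<integral>x. (\<Sum>j<m. v j * of_bool (fst x j = Some i)) \<partial>N) - (\<integral>x. snd x i \<partial>N)"
    using assms(3) by (simp only: case_prod_unfold)
      (intro Bochner_Integration.integral_diff Bochner_Integration.integrable_sum, auto)
  also have "(\<integral>x. (\<Sum>j<m. v j * of_bool (fst x j = Some i)) \<partial>N) =
      (\<Sum>j<m. (\<integral>x. v j * of_bool (fst x j = Some i) \<partial>N))"
    using int by (intro Bochner_Integration.integral_sum) auto
  finally show ?thesis
    by simp
qed

text \<open>Feasibility: \<open>fst x j\<close> is a single option value, so at most one of the
  events \<open>fst x j = Some i\<close> occurs in each outcome. The sum can be below 1 because the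
  item may stay unallocated.\<close>

lemma sum_assigned_le_1:
  assumes "prob_space N" "sets N = sets (outcome_space m n)" "j < m"
  shows "(\<Sum>i<n. (\<integral>x. of_bool (fst x j = Some i) \<partial>N)) \<le> (1::real)"
proof -
  interpret prob_space N by fact
  have le: "(\<Sum>i<n. of_bool (y = Some i)) \<le> (1::real)" for y
    by (cases y) (auto simp: of_bool_def)
  have "(\<Sum>i<n. (\<integral>x. of_bool (fst x j = Some i) \<partial>N)) =
      (\<integral>x. (\<Sum>i<n. of_bool (fst x j = Some i) :: real) \<partial>N)"
    using assigned_integrable[OF assms] by (intro Bochner_Integration.integral_sum[symmetric]) auto
  also have "\<dots> \<le> 1"
    using assigned_integrable[OF assms] le
    by (intro integral_le_const Bochner_Integration.integrable_sum) auto
  finally show ?thesis .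
qed

text \<open>The weights may sum to less than 1, so bounding by the maximum relies on that maximum
  being nonnegative. Only \<open>d\<close> is required to be nonnegative, which lets
  \<open>c\<close> contain negative virtual values while \<open>d\<close> contains their positive
  parts.\<close>

lemma sum_mult_le_Max:
  fixes c x :: "'a \<Rightarrow> real"
  assumes "finite I" "I \<noteq> {}" "\<And>i. i \<in> I \<Longrightarrow> 0 \<le> x i" "sum x I \<le> 1"
    "\<And>i. i \<in> I \<Longrightarrow> c i \<le> d i" "\<And>i. i \<in> I \<Longrightarrow> 0 \<le> d i"
  shows "(\<Sum>i\<in>I. c i * x i) \<le> (MAX i\<in>I. d i)"
proof -
  obtain k where "k \<in> I"
    using assms(2) by blast
  then have M: "0 \<le> (MAX i\<in>I. d i)"
    using assms(6)[of k] Max_ge[of "d ` I" "d k"] assms(1)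
    by (meson finite_imageI imageI order_trans)
  have "(\<Sum>i\<in>I. c i * x i) \<le> (\<Sum>i\<in>I. (MAX i\<in>I. d i) * x i)"
    using assms order_trans[OF assms(5) Max_ge[of "d ` I"]]
    by (intro sum_mono mult_right_mono) auto
  also have "\<dots> \<le> (MAX i\<in>I. d i)"
    using M assms(4) mult_left_mono[of "sum x I" 1] by (simp add: sum_distrib_left)
  finally show ?thesis .
qed

section \<open>Profiles and interim quantities\<close>

lemma finite_profile_pmf:
  assumes "finite I" "\<And>j. j < m \<Longrightarrow> finite (set_pmf (F j))"
  shows "finite (set_pmf (profile_pmf I m F))"
  unfolding profile_pmf_def using assms by (intro finite_set_Pi_pmf finite_valuation_pmf) auto

lemma fun_upd_in_set_profile_pmf:
  assumes "i < n" "w \<in> set_pmf (profile_pmf ({..<n} - {i}) m F)" "b \<in> set_pmf (valuation_pmf m F)"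
  shows "w(i := b) \<in> set_pmf (profile_pmf {..<n} m F)"
  using assms unfolding profile_pmf_def by (intro fun_upd_in_set_Pi_pmf) auto

text \<open>The swap puts the opponents' expectation inside, so that the inner integral is an
  interim quantity of bidder \<open>i\<close> as a function of the own bid.\<close>

lemma expectation_profile_pmf_split:
  fixes h :: "profile \<Rightarrow> real"
  assumes "\<And>j. j < m \<Longrightarrow> finite (set_pmf (F j))" "i < n"
  shows "measure_pmf.expectation (profile_pmf {..<n} m F) h =
    measure_pmf.expectation (valuation_pmf m F)
      (\<lambda>b. measure_pmf.expectation (profile_pmf ({..<n} - {i}) m F) (\<lambda>w. h (w(i := b))))"
proof -
  have "measure_pmf.expectation (profile_pmf {..<n} m F) h =
    measure_pmf.expectation (profile_pmf ({..<n} - {i}) m F)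
      (\<lambda>w. measure_pmf.expectation (valuation_pmf m F) (\<lambda>b. h (w(i := b))))"
    unfolding profile_pmf_def using assms
    by (intro expectation_Pi_pmf_split) (auto intro: finite_valuation_pmf)
  then show ?thesis
    using assms
    by (subst expectation_swap_finite) (simp_all add: finite_profile_pmf finite_valuation_pmf)
qed

definition item_prob :: "mechanism \<Rightarrow> nat \<Rightarrow> nat \<Rightarrow> profile \<Rightarrow> real" where
  "item_prob M i j b = (\<integral>x. of_bool (fst x j = Some i) \<partial>M b)"

text \<open>The item is the last argument, so that fixing the bidder gives a function of bid and
  item of the shape \<open>x b j\<close> used in
  \<open>expected_utility_lower_bound\<close>.\<close>

definition interim_item_prob ::
  "nat \<Rightarrow> nat \<Rightarrow> (nat \<Rightarrow> real pmf) \<Rightarrow> mechanism \<Rightarrow> nat \<Rightarrow> valuation \<Rightarrow> nat \<Rightarrow> real" where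
  "interim_item_prob m n F M i b j =
     measure_pmf.expectation (profile_pmf ({..<n} - {i}) m F) (\<lambda>w. item_prob M i j (w(i := b)))"

definition payment :: "mechanism \<Rightarrow> nat \<Rightarrow> profile \<Rightarrow> real" where
  "payment M i b = (\<integral>x. snd x i \<partial>M b)"

text \<open>The true valuation \<open>v\<close> enters linearly, while winning probabilities and
  payment depend only on the bid \<open>b\<close>. This turns a comparison of reports into a linear
  inequality in \<open>v - b\<close>.\<close>

lemma interim_utility_eq:
  assumes mech: "is_mechanism m n F M" and fin: "\<And>j. j < m \<Longrightarrow> finite (set_pmf (F j))"
    and i: "i < n" and b: "b \<in> set_pmf (valuation_pmf m F)"
  shows "interim_utility m n F M i v b = (\<Sum>j<m. v j * interim_item_prob m n F M i b j) -
    measure_pmf.expectation (profile_pmf ({..<n} - {i}) m F) (\<lambda>w. payment M i (w(i := b)))"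
proof -
  \<comment> \<open>\<open>is_mechanism\<close> constrains \<open>M\<close> only on the support, and
    \<open>w(i := b)\<close> lies there because \<open>b\<close> does.\<close>
  have *: "(\<integral>x. bidder_utility m i v x \<partial>M (w(i := b)))
      = (\<Sum>j<m. v j * item_prob M i j (w(i := b))) - payment M i (w(i := b))"
    if "w \<in> set_pmf (profile_pmf ({..<n} - {i}) m F)" for w
    using mech i fun_upd_in_set_profile_pmf[OF i that b] unfolding item_prob_def payment_def
    by (intro integral_bidder_utility[of _ m n]) (auto simp: is_mechanism_def)
  note int = integrable_measure_pmf_finite[OF finite_profile_pmf[OF _ fin]]
  show ?thesis
    unfolding interim_utility_def interim_item_prob_def
    by (subst expectation_cong_support[OF *])
      (simp_all add: int Bochner_Integration.integral_diff)
qed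

text \<open>Payment is welfare minus utility, and the utility is replaced by its lower bound. The
  resulting coefficient of the winning probability is the virtual value inside the region of item
  \<open>j\<close> and the plain value outside.\<close>

lemma expected_payment_bound:
  assumes mech: "is_mechanism m n F M" and bic: "BIC m n F M" and bir: "BIR m n F M"
    and fin: "\<And>j. j < m \<Longrightarrow> finite (set_pmf (F j))" and i: "i < n"
  shows "measure_pmf.expectation (profile_pmf {..<n} m F) (payment M i) \<le>
    measure_pmf.expectation (profile_pmf {..<n} m F)
      (\<lambda>v. \<Sum>j<m. (v i j - (v i j - virtual_value (F j) (v i j)) *
        indicator (quantile_region m F j) (v i)) * item_prob M i j v)"
proof -
  let ?V = "valuation_pmf m F" and ?P = "profile_pmf ({..<n} - {i}) m F"
  let ?x = "interim_item_prob m n F M i" and ?u = "\<lambda>v. interim_utility m n F M i v v"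
  let ?R = "\<lambda>j. indicator (quantile_region m F j) :: valuation \<Rightarrow> real"
  let ?S = "\<lambda>b. \<Sum>j<m. (b j - virtual_value (F j) (b j)) * ?x b j * ?R j b"
  have utility: "interim_utility m n F M i v b = (\<Sum>j<m. v j * ?x b j) -
      measure_pmf.expectation ?P (\<lambda>w. payment M i (w(i := b)))"
    if "b \<in> set_pmf ?V" for v b
    using mech fin i that by (rule interim_utility_eq)
  note intV = integrable_measure_pmf_finite[OF finite_valuation_pmf[OF fin]]
  note intP = integrable_measure_pmf_finite[OF finite_profile_pmf[OF _ fin]]
  have lower: "measure_pmf.expectation ?V ?S \<le> measure_pmf.expectation ?V ?u"
  proof (rule expected_utility_lower_bound[OF fin])
    show "0 \<le> ?u v" if "v \<in> set_pmf ?V" for v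
      using bir i that by (simp add: BIR_def)
    show "?u b + (\<Sum>j<m. (v j - b j) * ?x b j) \<le> ?u v"
      if "v \<in> set_pmf ?V" "b \<in> set_pmf ?V" for v b
    proof -
      \<comment> \<open>The left side is the utility of type \<open>v\<close> when bidding
        \<open>b\<close>, so \<open>BIC\<close> is exactly the required inequality.\<close>
      have "?u b + (\<Sum>j<m. (v j - b j) * ?x b j) = interim_utility m n F M i v b"
        unfolding utility[OF that(2)] by (simp add: left_diff_distrib sum_subtractf)
      then show ?thesis
        using bic i that by (simp add: BIC_def)
    qed
  qed
  have "measure_pmf.expectation (profile_pmf {..<n} m F) (payment M i)
      = measure_pmf.expectation ?V (\<lambda>b. measure_pmf.expectation ?P (\<lambda>w. payment M i (w(i := b))))"
    by (rule expectation_profile_pmf_split[OF fin i])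
  also have "\<dots> = measure_pmf.expectation ?V (\<lambda>b. (\<Sum>j<m. b j * ?x b j) - ?u b)"
    by (rule expectation_cong_support) (simp add: utility)
  also have "\<dots> = measure_pmf.expectation ?V (\<lambda>b. \<Sum>j<m. b j * ?x b j) - measure_pmf.expectation ?V ?u"
    by (intro Bochner_Integration.integral_diff intV)
  also have "\<dots> \<le> measure_pmf.expectation ?V (\<lambda>b. \<Sum>j<m. b j * ?x b j) - measure_pmf.expectation ?V ?S"
    using lower by simp
  also have "\<dots> = measure_pmf.expectation ?V (\<lambda>b. (\<Sum>j<m. b j * ?x b j) - ?S b)"
    by (intro Bochner_Integration.integral_diff[symmetric] intV)
  also have "\<dots> = measure_pmf.expectation ?V
      (\<lambda>b. \<Sum>j<m. (b j - (b j - virtual_value (F j) (b j)) * ?R j b) * ?x b j)"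
    by (simp add: sum_subtractf[symmetric] algebra_simps)
  \<comment> \<open>Back from interim to profilewise probabilities: feasibility across bidders holds
    within each single profile.\<close>
  also have "\<dots> = measure_pmf.expectation ?V (\<lambda>b. measure_pmf.expectation ?P
      (\<lambda>w. \<Sum>j<m. (b j - (b j - virtual_value (F j) (b j)) * ?R j b) * item_prob M i j (w(i := b))))"
    unfolding interim_item_prob_def by (simp add: intP Bochner_Integration.integral_sum)
  also have "\<dots> = measure_pmf.expectation (profile_pmf {..<n} m F)
      (\<lambda>v. \<Sum>j<m. (v i j - (v i j - virtual_value (F j) (v i j)) * ?R j (v i)) * item_prob M i j v)"
    by (subst expectation_profile_pmf_split[OF fin i]) simp_all
  finally show ?thesis .
qed

lemma profile_pmf_value_nonneg:
  assumes "\<And>j. j < m \<Longrightarrow> set_pmf (F j) \<subseteq> {0..}"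
    and "v \<in> set_pmf (profile_pmf {..<n} m F)" "i < n" "j < m"
  shows "0 \<le> v i j"
proof -
  have "v i \<in> set_pmf (valuation_pmf m F)"
    using assms(2,3) by (auto simp: profile_pmf_def set_Pi_pmf PiE_dflt_def)
  then have "v i j \<in> set_pmf (F j)"
    using assms(4) by (auto simp: valuation_pmf_def set_Pi_pmf PiE_dflt_def)
  then show ?thesis
    using assms(1,4) by force
qed

section \<open>Revenue and the final bound\<close>

lemma revenue_eq_sum_payment:
  assumes mech: "is_mechanism m n F M" and fin: "\<And>j. j < m \<Longrightarrow> finite (set_pmf (F j))"
  shows "revenue m n F M =
    (\<Sum>i<n. measure_pmf.expectation (profile_pmf {..<n} m F) (payment M i))"
proof -
  have "(\<integral>(a, p). (\<Sum>i<n. p i) \<partial>M v) = (\<Sum>i<n. payment M i v)"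
    if "v \<in> set_pmf (profile_pmf {..<n} m F)" for v
    using mech that unfolding payment_def case_prod_unfold
    by (intro Bochner_Integration.integral_sum) (auto simp: is_mechanism_def case_prod_unfold)
  then have "revenue m n F M =
      measure_pmf.expectation (profile_pmf {..<n} m F) (\<lambda>v. \<Sum>i<n. payment M i v)"
    unfolding revenue_def by (rule expectation_cong_support)
  also have "\<dots> = (\<Sum>i<n. measure_pmf.expectation (profile_pmf {..<n} m F) (payment M i))"
    using fin
    by (intro Bochner_Integration.integral_sum integrable_measure_pmf_finite finite_profile_pmf) auto
  finally show ?thesis .
qed

theorem theorem3p4:
  fixes m n :: nat and F :: "nat \<Rightarrow> real pmf"
  assumes "n \<ge> 1"
    and "\<And>j. j < m \<Longrightarrow> finite (set_pmf (F j))"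
    and "\<And>j. j < m \<Longrightarrow> set_pmf (F j) \<subseteq> {0..}"
  shows "Rev m n F \<le>
    ereal (\<Sum>j<m. measure_pmf.expectation (profile_pmf {..<n} m F)
      (\<lambda>v. MAX i\<in>{..<n}.
         max (virtual_value (F j) (v i j)) 0 * indicator (quantile_region m F j) (v i) +
         v i j * indicator (- quantile_region m F j) (v i)))"
  unfolding Rev_def
proof (intro SUP_least, clarsimp)
  fix M assume M: "is_mechanism m n F M" "BIC m n F M" "BIR m n F M"
  let ?P = "profile_pmf {..<n} m F"
  let ?E = "measure_pmf.expectation ?P"
  let ?R = "quantile_region m F"
  let ?c = "\<lambda>j v i. v i j - (v i j - virtual_value (F j) (v i j)) * indicator (?R j) (v i)"
  let ?d = "\<lambda>j v i. max (virtual_value (F j) (v i j)) 0 * indicator (?R j) (v i) +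
         v i j * indicator (- ?R j) (v i)"
  have finP: "finite (set_pmf ?P)"
    using assms(2) by (simp add: finite_profile_pmf)
  note int = integrable_measure_pmf_finite[OF finP]
  have "revenue m n F M = (\<Sum>i<n. ?E (payment M i))"
    using M(1) assms(2) by (rule revenue_eq_sum_payment)
  also have "\<dots> \<le> (\<Sum>i<n. ?E (\<lambda>v. \<Sum>j<m. ?c j v i * item_prob M i j v))"
    using M assms(2) by (intro sum_mono expected_payment_bound) auto
  \<comment> \<open>Bidders become the innermost sum, so that for each item and profile the winning
    probabilities act as weights of total at most 1.\<close>
  also have "\<dots> = (\<Sum>j<m. ?E (\<lambda>v. \<Sum>i<n. ?c j v i * item_prob M i j v))"
    by (simp add: Bochner_Integration.integral_sum int sum.swap[of _ "{..<m}"])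
  also have "\<dots> \<le> (\<Sum>j<m. ?E (\<lambda>v. MAX i\<in>{..<n}. ?d j v i))"
  proof (intro sum_mono expectation_mono_support finP sum_mult_le_Max)
    fix j v i assume j: "j \<in> {..<m}" and v: "v \<in> set_pmf ?P"
    show "sum (\<lambda>i. item_prob M i j v) {..<n} \<le> 1"
      using M(1) v j unfolding item_prob_def
      by (intro sum_assigned_le_1) (auto simp: is_mechanism_def)
    show "0 \<le> item_prob M i j v"
      by (simp add: item_prob_def)
    assume "i \<in> {..<n}"
    \<comment> \<open>Outside the region \<open>?c\<close> and \<open>?d\<close> both equal the
      value, so \<open>?d\<close> is nonnegative there because the supports lie in the nonnegative
      reals; inside, \<open>?d\<close> is the positive part of \<open>?c\<close>.\<close>
    then have "0 \<le> v i j"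
      using profile_pmf_value_nonneg[OF assms(3) v] j by simp
    then show "?c j v i \<le> ?d j v i" "0 \<le> ?d j v i"
      by (auto simp: indicator_def)
  \<comment> \<open>At least one bidder makes the index set of the maximum nonempty.\<close>
  qed (use assms(1) in \<open>auto simp: lessThan_empty_iff\<close>)
  finally show "revenue m n F M \<le> (\<Sum>j<m. ?E (\<lambda>v. MAX i\<in>{..<n}. ?d j v i))" .
qed

end
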